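(* Let $\psi\in L^2(\mathbb{R})$ be such that $\{D_{2^j}T_k\psi\}_{j,k\in\mathbb{Z}}$ is an orthonormal basis for $L^2(\mathbb{R})$. Let $\eta\in(0,1)$ and define $\theta:=\psi+\eta D_2\psi$. Then for every $\varphi\in L^2(\mathbb{R})$ such that $\{D_{2^j}T_k\varphi\}_{j,k\in\mathbb{Z}}$ is a Bessel sequence, $$\sup_{\|f\|=1}\left\|f-\sum_{j,k\in\mathbb{Z}}\langle f,D_{2^j}T_k\varphi\rangle D_{2^j}T_k\theta\right\|^2\ge\frac{(1-\eta)^2}{4}\left(\frac{1}{\sqrt{1-\eta^2}}-1\right)^2,$$ where the supremum is over all $f\in L^2(\mathbb{R})$ with $\|f\|=1$.
   Context: For $a>0$ and $b\in\mathbb{R}$, the scaling and translation operators on $L^2(\mathbb{R})$ are $D_af(x)=a^{1/2}f(ax)$ and $T_bf(x)=f(x-b)$. A sequence $\{f_k\}_{k\in I}$ in a Hilbert space $\mathcal{H}$, with $I$ countable, is a Bessel sequence if there is $B>0$ with $\sum_{k\in I}|\langle f,f_k\rangle|^2\le B\|f\|^2$ for all $f\in\mathcal{H}$. It is known that the system $\{D_{2^j}T_k\theta\}_{j,k\in\mathbb{Z}}$ is a Riesz basis for $L^2(\mathbb{R})$ (hence a frame). *)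

theory Defs
  imports "HOL-Analysis.Analysis"
begin

definition square_integrable :: "(real \<Rightarrow> complex) \<Rightarrow> bool" where
  "square_integrable f \<longleftrightarrow>
     f \<in> borel_measurable lborel \<and> integrable lborel (\<lambda>x. (cmod (f x))\<^sup>2)"

lemma square_integrable_measurable [measurable_dest]:
  "square_integrable f \<Longrightarrow> f \<in> borel_measurable lborel"
  by (simp add: square_integrable_def)

lemma square_integrable_integrable:
  "square_integrable f \<Longrightarrow> integrable lborel (\<lambda>x. (cmod (f x))\<^sup>2)"
  by (simp add: square_integrable_def)

lemma square_integrable_zero: "square_integrable (\<lambda>x. 0)"
  by (simp add: square_integrable_def)

lemma square_integrable_add:
  assumes "square_integrable f" "square_integrable g"
  shows "square_integrable (\<lambda>x. f x + g x)"
proof -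
  note [measurable] = assms[THEN square_integrable_measurable]
  have "integrable lborel (\<lambda>x. (cmod (f x + g x))\<^sup>2)"
  proof (rule Bochner_Integration.integrable_bound)
    show "integrable lborel (\<lambda>x. 2 * (cmod (f x))\<^sup>2 + 2 * (cmod (g x))\<^sup>2)"
      using assms by (intro Bochner_Integration.integrable_add integrable_mult_right
                        square_integrable_integrable)
    have "(cmod (f x + g x))\<^sup>2 \<le> 2 * (cmod (f x))\<^sup>2 + 2 * (cmod (g x))\<^sup>2" for x
    proof -
      have "(cmod (f x + g x))\<^sup>2 \<le> (cmod (f x) + cmod (g x))\<^sup>2"
        by (intro power_mono norm_triangle_ineq) simp
      also have "\<dots> \<le> 2 * (cmod (f x))\<^sup>2 + 2 * (cmod (g x))\<^sup>2"
        using sum_squares_bound[of "cmod (f x)" "cmod (g x)"] by (simp add: power2_sum)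
      finally show ?thesis .
    qed
    then show "AE x in lborel. norm ((cmod (f x + g x))\<^sup>2)
                 \<le> norm (2 * (cmod (f x))\<^sup>2 + 2 * (cmod (g x))\<^sup>2)"
      by simp
  qed simp
  then show ?thesis by (simp add: square_integrable_def)
qed

lemma square_integrable_scale:
  assumes "square_integrable f"
  shows "square_integrable (\<lambda>x. c * f x)"
  using assms by (auto simp: square_integrable_def norm_mult power_mult_distrib
      intro: borel_measurable_times)

lemma square_integrable_affine:
  assumes "square_integrable f" "a \<noteq> 0"
  shows "square_integrable (\<lambda>x. f (b + a * x))"
proof -
  note [measurable] = assms(1)[THEN square_integrable_measurable]
  have "integrable lborel (\<lambda>x. (cmod (f (b + a * x)))\<^sup>2)"
    using lborel_integrable_real_affine[OF square_integrable_integrable[OF assms(1)] assms(2)] .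
  then show ?thesis by (simp add: square_integrable_def)
qed

lemma square_integrable_dilate:
  assumes "square_integrable f"
  shows "square_integrable (\<lambda>x. complex_of_real (sqrt a) * f (a * x))"
proof (cases "a = 0")
  case False
  then show ?thesis
    using square_integrable_scale[OF square_integrable_affine[OF assms False, of 0]] by simp
qed (simp add: square_integrable_zero)

lemma square_integrable_translate:
  assumes "square_integrable f"
  shows "square_integrable (\<lambda>x. f (x - b))"
  using square_integrable_affine[OF assms, of 1 "- b"] by simp

lemma borel_measurable_cnj [measurable]: "cnj \<in> borel_measurable borel"
  by (intro borel_measurable_continuous_onI continuous_intros)

lemma integrable_mult_cnj:
  assumes "square_integrable f" "square_integrable g"
  shows "integrable lborel (\<lambda>x. f x * cnj (g x))"
proof -
  note [measurable] = assms[THEN square_integrable_measurable]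
  show ?thesis
  proof (rule Bochner_Integration.integrable_bound)
    show "integrable lborel (\<lambda>x. (cmod (f x))\<^sup>2 + (cmod (g x))\<^sup>2)"
      using assms by (intro Bochner_Integration.integrable_add square_integrable_integrable)
    have "cmod (f x) * cmod (g x) \<le> (cmod (f x))\<^sup>2 + (cmod (g x))\<^sup>2" for x
      using sum_squares_bound[of "cmod (f x)" "cmod (g x)"]
        mult_nonneg_nonneg[OF norm_ge_zero[of "f x"] norm_ge_zero[of "g x"]] by linarith
    then show "AE x in lborel. norm (f x * cnj (g x)) \<le> norm ((cmod (f x))\<^sup>2 + (cmod (g x))\<^sup>2)"
      by (simp add: norm_mult)
  qed measurable
qed

text \<open>Elements of \<open>L2\<close> are classes of square-integrable Borel functions modulo equality almost
  everywhere. Every Lebesgue measurable function agrees almost everywhere with a Borel function,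
  so using Borel functions loses nothing.\<close>

definition L2_rel :: "(real \<Rightarrow> complex) \<Rightarrow> (real \<Rightarrow> complex) \<Rightarrow> bool" where
  "L2_rel f g \<longleftrightarrow> square_integrable f \<and> square_integrable g \<and> (AE x in lborel. f x = g x)"

quotient_type L2 = "real \<Rightarrow> complex" / partial: L2_rel
proof (rule part_equivpI)
  show "\<exists>f. L2_rel f f"
    using square_integrable_zero by (auto simp: L2_rel_def)
  show "symp L2_rel"
    by (auto simp: symp_def L2_rel_def elim: eventually_mono)
  show "transp L2_rel"
    unfolding transp_def L2_rel_def by (auto elim: eventually_elim2)
qed

instantiation L2 :: real_vector
begin

lift_definition zero_L2 :: L2 is "\<lambda>x. 0"
  by (simp add: L2_rel_def square_integrable_zero)

lift_definition plus_L2 :: "L2 \<Rightarrow> L2 \<Rightarrow> L2" is "\<lambda>f g x. f x + g x"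
  by (auto simp: L2_rel_def intro: square_integrable_add elim: eventually_elim2)

lift_definition uminus_L2 :: "L2 \<Rightarrow> L2" is "\<lambda>f x. - f x"
  using square_integrable_scale[of _ "-1"] by (auto simp: L2_rel_def elim: eventually_mono)

lift_definition scaleR_L2 :: "real \<Rightarrow> L2 \<Rightarrow> L2" is "\<lambda>r f x. complex_of_real r * f x"
  by (auto simp: L2_rel_def intro: square_integrable_scale elim: eventually_mono)

definition minus_L2 :: "L2 \<Rightarrow> L2 \<Rightarrow> L2" where
  "minus_L2 f g = f + (- g)"

instance
proof
  fix f g h :: L2 and r s :: real
  show "f + g + h = f + (g + h)"
    by transfer (auto simp: L2_rel_def add.assoc intro: square_integrable_add)
  show "f + g = g + f"
    by transfer (auto simp: L2_rel_def add.commute intro: square_integrable_add)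
  show "0 + f = f"
    by transfer (auto simp: L2_rel_def)
  show "- f + f = 0"
    by transfer (auto simp: L2_rel_def square_integrable_zero)
  show "f - g = f + - g"
    by (simp add: minus_L2_def)
  show "r *\<^sub>R (f + g) = r *\<^sub>R f + r *\<^sub>R g"
    by transfer (auto simp: L2_rel_def distrib_left
        intro!: square_integrable_add square_integrable_scale)
  show "(r + s) *\<^sub>R f = r *\<^sub>R f + s *\<^sub>R f"
    by transfer (auto simp: L2_rel_def distrib_right
        intro!: square_integrable_add square_integrable_scale)
  show "r *\<^sub>R s *\<^sub>R f = (r * s) *\<^sub>R f"
    by transfer (auto simp: L2_rel_def mult.assoc intro!: square_integrable_scale)
  show "1 *\<^sub>R f = f"
    by transfer (auto simp: L2_rel_def)
qed

end

lift_definition scaleC :: "complex \<Rightarrow> L2 \<Rightarrow> L2" (infixr \<open>*\<^sub>C\<close> 75) is "\<lambda>c f x. c * f x"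
  by (auto simp: L2_rel_def intro: square_integrable_scale elim: eventually_mono)

global_interpretation L2: vector_space scaleC
  defines cspan = L2.span
proof
  fix f g :: L2 and c d :: complex
  show "c *\<^sub>C (f + g) = c *\<^sub>C f + c *\<^sub>C g"
    by transfer (auto simp: L2_rel_def distrib_left
        intro!: square_integrable_add square_integrable_scale)
  show "(c + d) *\<^sub>C f = c *\<^sub>C f + d *\<^sub>C f"
    by transfer (auto simp: L2_rel_def distrib_right
        intro!: square_integrable_add square_integrable_scale)
  show "c *\<^sub>C d *\<^sub>C f = (c * d) *\<^sub>C f"
    by transfer (auto simp: L2_rel_def mult.assoc intro!: square_integrable_scale)
  show "1 *\<^sub>C f = f"
    by transfer (auto simp: L2_rel_def)
qed

lemma scaleR_scaleC: "r *\<^sub>R f = complex_of_real r *\<^sub>C f"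
  by transfer (auto simp: L2_rel_def intro: square_integrable_scale)

text \<open>The complex inner product is linear in its first argument. The library class \<open>real_inner\<close>
  is for real inner products; it is instantiated below with the real part, which gives the same
  norm.\<close>

lift_definition cinner :: "L2 \<Rightarrow> L2 \<Rightarrow> complex" is "\<lambda>f g. \<integral>x. f x * cnj (g x) \<partial>lborel"
proof -
  fix f f' g g' :: "real \<Rightarrow> complex"
  assume *: "L2_rel f f'" "L2_rel g g'"
  then have [measurable]: "f \<in> borel_measurable lborel" "f' \<in> borel_measurable lborel"
    "g \<in> borel_measurable lborel" "g' \<in> borel_measurable lborel"
    by (auto simp: L2_rel_def dest: square_integrable_measurable)
  have "AE x in lborel. f x * cnj (g x) = f' x * cnj (g' x)"
    using * by (auto simp: L2_rel_def elim: eventually_elim2)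
  then show "(\<integral>x. f x * cnj (g x) \<partial>lborel) = (\<integral>x. f' x * cnj (g' x) \<partial>lborel)"
    by (intro integral_cong_AE) measurable
qed

instantiation L2 :: real_inner
begin

lift_definition norm_L2 :: "L2 \<Rightarrow> real" is "\<lambda>f. sqrt (\<integral>x. (cmod (f x))\<^sup>2 \<partial>lborel)"
proof -
  fix f f' :: "real \<Rightarrow> complex"
  assume *: "L2_rel f f'"
  then have [measurable]: "f \<in> borel_measurable lborel" "f' \<in> borel_measurable lborel"
    by (auto simp: L2_rel_def dest: square_integrable_measurable)
  have "AE x in lborel. (cmod (f x))\<^sup>2 = (cmod (f' x))\<^sup>2"
    using * by (auto simp: L2_rel_def elim: eventually_mono)
  then have "(\<integral>x. (cmod (f x))\<^sup>2 \<partial>lborel) = (\<integral>x. (cmod (f' x))\<^sup>2 \<partial>lborel)"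
    by (intro integral_cong_AE) measurable
  then show "sqrt (\<integral>x. (cmod (f x))\<^sup>2 \<partial>lborel) = sqrt (\<integral>x. (cmod (f' x))\<^sup>2 \<partial>lborel)"
    by simp
qed

definition inner_L2 :: "L2 \<Rightarrow> L2 \<Rightarrow> real" where
  "inner_L2 f g = Re (cinner f g)"

definition dist_L2 :: "L2 \<Rightarrow> L2 \<Rightarrow> real" where
  "dist_L2 f g = norm (f - g)"

definition sgn_L2 :: "L2 \<Rightarrow> L2" where
  "sgn_L2 f = f /\<^sub>R norm f"

definition uniformity_L2 :: "(L2 \<times> L2) filter" where
  "uniformity_L2 = (INF e\<in>{0<..}. principal {(f, g). dist f g < e})"

definition open_L2 :: "L2 set \<Rightarrow> bool" where
  "open_L2 U \<longleftrightarrow> (\<forall>f\<in>U. \<forall>\<^sub>F (f', g) in uniformity. f' = f \<longrightarrow> g \<in> U)"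

lemma cinner_self: "cinner f f = complex_of_real ((norm f)\<^sup>2)"
  by transfer (simp add: complex_norm_square[symmetric] del: of_real_power)

lemma cinner_add_left: "cinner (f + g) h = cinner f h + cinner g h"
  by transfer (simp add: L2_rel_def distrib_right integrable_mult_cnj)

lemma cinner_scaleC_left: "cinner (c *\<^sub>C f) g = c * cinner f g"
  by transfer (simp add: mult.assoc)

lemma cinner_commute: "cinner f g = cnj (cinner g f)"
proof transfer
  fix f g :: "real \<Rightarrow> complex"
  show "(\<integral>x. f x * cnj (g x) \<partial>lborel) = cnj (\<integral>x. g x * cnj (f x) \<partial>lborel)"
    using Bochner_Integration.integral_cnj[of lborel "\<lambda>x. g x * cnj (f x)"]
    by (simp add: mult.commute)
qed

lemma norm_eq_0_iff_L2: "norm f = 0 \<longleftrightarrow> f = (0::L2)"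
proof transfer
  fix f :: "real \<Rightarrow> complex"
  assume "L2_rel f f"
  then have sq: "square_integrable f" by (simp add: L2_rel_def)
  have "sqrt (\<integral>x. (cmod (f x))\<^sup>2 \<partial>lborel) = 0 \<longleftrightarrow> (AE x in lborel. (cmod (f x))\<^sup>2 = 0)"
    using integral_nonneg_eq_0_iff_AE[OF square_integrable_integrable[OF sq]] by simp
  also have "\<dots> \<longleftrightarrow> L2_rel f (\<lambda>x. 0)"
    using sq by (simp add: L2_rel_def square_integrable_zero)
  finally show "sqrt (\<integral>x. (cmod (f x))\<^sup>2 \<partial>lborel) = 0 \<longleftrightarrow> L2_rel f (\<lambda>x. 0)" .
qed

lemma norm_nonneg_L2: "0 \<le> norm (f::L2)"
  by transfer simp

instance
proof
  fix f g h :: L2 and r :: real and U :: "L2 set"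
  show "dist f g = norm (f - g)"
    by (rule dist_L2_def)
  show "sgn f = f /\<^sub>R norm f"
    by (rule sgn_L2_def)
  show "(uniformity :: (L2 \<times> L2) filter) = (INF e\<in>{0<..}. principal {(f, g). dist f g < e})"
    by (rule uniformity_L2_def)
  show "open U \<longleftrightarrow> (\<forall>f\<in>U. \<forall>\<^sub>F (f', g) in uniformity. f' = f \<longrightarrow> g \<in> U)"
    by (rule open_L2_def)
  show "inner f g = inner g f"
    unfolding inner_L2_def by (subst cinner_commute) simp
  show "inner (f + g) h = inner f h + inner g h"
    by (simp add: inner_L2_def cinner_add_left)
  show "inner (r *\<^sub>R f) g = r * inner f g"
    by (simp add: inner_L2_def scaleR_scaleC cinner_scaleC_left)
  show "0 \<le> inner f f"
    by (simp add: inner_L2_def cinner_self)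
  show "inner f f = 0 \<longleftrightarrow> f = 0"
    by (simp add: inner_L2_def cinner_self norm_eq_0_iff_L2)
  show "norm f = sqrt (inner f f)"
    by (simp add: inner_L2_def cinner_self norm_nonneg_L2)
qed

end

definition orthonormal_basis :: "('i \<Rightarrow> L2) \<Rightarrow> bool" where
  "orthonormal_basis e \<longleftrightarrow>
     (\<forall>i j. cinner (e i) (e j) = (if i = j then 1 else 0)) \<and>
     closure (cspan (range e)) = UNIV"

definition bessel_sequence :: "('i::countable \<Rightarrow> L2) \<Rightarrow> bool" where
  "bessel_sequence g \<longleftrightarrow>
     (\<exists>B>0. \<forall>f. (\<lambda>i. (cmod (cinner f (g i)))\<^sup>2) summable_on UNIV \<and>
                (\<Sum>\<^sub>\<infinity>i. (cmod (cinner f (g i)))\<^sup>2) \<le> B * (norm f)\<^sup>2)"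

text \<open>Only \<open>a > 0\<close> is of interest; the formula is also well defined on classes for \<open>a = 0\<close>,
  where it gives \<open>0\<close>, and for \<open>a < 0\<close>.\<close>

lift_definition dilation :: "real \<Rightarrow> L2 \<Rightarrow> L2" is
  "\<lambda>a f x. complex_of_real (sqrt a) * f (a * x)"
proof -
  fix a :: real and f g :: "real \<Rightarrow> complex"
  assume *: "L2_rel f g"
  have "AE x in lborel. complex_of_real (sqrt a) * f (a * x) = complex_of_real (sqrt a) * g (a * x)"
  proof (cases "a = 0")
    case False
    have [measurable]: "f \<in> borel_measurable lborel" "g \<in> borel_measurable lborel"
      using * by (auto simp: L2_rel_def dest: square_integrable_measurable)
    have "AE x in lborel. f (0 + a * x) = g (0 + a * x)"
      using * False by (intro AE_borel_affine) (auto simp: L2_rel_def)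
    then show ?thesis by (auto elim: eventually_mono)
  qed simp
  then show "L2_rel (\<lambda>x. complex_of_real (sqrt a) * f (a * x))
                    (\<lambda>x. complex_of_real (sqrt a) * g (a * x))"
    using * by (auto simp: L2_rel_def intro: square_integrable_dilate)
qed

lift_definition translation :: "real \<Rightarrow> L2 \<Rightarrow> L2" is "\<lambda>b f x. f (x - b)"
proof -
  fix b :: real and f g :: "real \<Rightarrow> complex"
  assume *: "L2_rel f g"
  have [measurable]: "f \<in> borel_measurable lborel" "g \<in> borel_measurable lborel"
    using * by (auto simp: L2_rel_def dest: square_integrable_measurable)
  have "AE x in lborel. f (- b + 1 * x) = g (- b + 1 * x)"
    using * by (intro AE_borel_affine) (auto simp: L2_rel_def)
  then show "L2_rel (\<lambda>x. f (x - b)) (\<lambda>x. g (x - b))"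
    using * by (auto simp: L2_rel_def intro: square_integrable_translate)
qed

definition wavelet_system :: "L2 \<Rightarrow> int \<times> int \<Rightarrow> L2" where
  "wavelet_system f = (\<lambda>(j, k). dilation (2 powi j) (translation (of_int k) f))"

end

(* Pairing f - (\<Sum>i. <f, \<phi>_i> \<theta>_i) with a fixed vector e moves the sum onto e: if the error is at
   most \<delta> on unit vectors, then e - (\<Sum>i. <e, \<theta>_i> \<phi>_i) has norm at most \<delta> * norm e. Now
   \<theta>_(j,k) = \<psi>_(j,k) + \<eta> \<psi>_(j+1,2k), and odd translates are never of the form \<psi>_(j+1,2k). So the
   choices e = \<psi>_(0,1) and e = \<psi>_(0,0) show that both \<psi> - \<phi> and \<psi> - \<phi> - \<eta> \<phi>_(-1,0) have norm
   at most \<delta>. As norm \<phi>_(-1,0) = norm \<phi> \<ge> 1 - \<delta>, this gives \<eta> (1 - \<delta>) \<le> 2 \<delta>, that is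
   \<delta> \<ge> \<eta> / (2 + \<eta>), which exceeds the claimed bound. *)

theory Submission
  imports Defs
begin

lemma cinner_add_right: "cinner f (g + h) = cinner f g + cinner f h"
proof -
  have "cinner f (g + h) = cnj (cinner (g + h) f)" by (rule cinner_commute)
  also have "\<dots> = cnj (cinner g f) + cnj (cinner h f)" by (simp add: cinner_add_left)
  finally show ?thesis by (simp only: cinner_commute[symmetric])
qed

lemma cinner_scaleC_right: "cinner f (c *\<^sub>C g) = cnj c * cinner f g"
proof -
  have "cinner f (c *\<^sub>C g) = cnj (cinner (c *\<^sub>C g) f)" by (rule cinner_commute)
  also have "\<dots> = cnj c * cnj (cinner g f)" by (simp add: cinner_scaleC_left)
  finally show ?thesis by (simp only: cinner_commute[symmetric])
qed

lemma cinner_scaleR_right: "cinner f (r *\<^sub>R g) = of_real r * cinner f g"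
  by (simp add: scaleR_scaleC cinner_scaleC_right)

lemma inner_scaleC_left: "inner (c *\<^sub>C f) g = Re (c * cinner f g)"
  by (simp add: inner_L2_def cinner_scaleC_left)

lemma inner_scaleC_right: "inner f (c *\<^sub>C g) = Re (cnj c * cinner f g)"
  by (simp add: inner_L2_def cinner_scaleC_right)

lemma translation_add: "translation b (f + g) = translation b f + translation b g"
  by transfer (auto simp: L2_rel_def intro!: square_integrable_add square_integrable_translate)

lemma translation_scaleR: "translation b (r *\<^sub>R f) = r *\<^sub>R translation b f"
  by transfer (auto simp: L2_rel_def intro!: square_integrable_scale square_integrable_translate)

lemma dilation_add: "dilation a (f + g) = dilation a f + dilation a g"
  by transfer (auto simp: L2_rel_def distrib_left
      intro!: square_integrable_add square_integrable_dilate)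

lemma dilation_scaleR: "dilation a (r *\<^sub>R f) = r *\<^sub>R dilation a f"
  by transfer (auto simp: L2_rel_def mult.left_commute
      intro!: square_integrable_scale square_integrable_dilate)

text \<open>\<open>sqrt\<close> is odd and multiplicative on all of the reals, so the composition
  law holds for every sign of \<open>a\<close> and \<open>b\<close>.\<close>

lemma dilation_dilation: "dilation a (dilation b f) = dilation (a * b) f"
proof transfer
  fix a b :: real and f :: "real \<Rightarrow> complex"
  assume "L2_rel f f"
  then have "square_integrable f" by (simp add: L2_rel_def)
  moreover have "complex_of_real (sqrt a) * (complex_of_real (sqrt b) * f (b * (a * x))) =
      complex_of_real (sqrt (a * b)) * f (a * b * x)" for x
    by (simp add: real_sqrt_mult mult_ac)
  ultimately show "L2_rel
      (\<lambda>x. complex_of_real (sqrt a) * (complex_of_real (sqrt b) * f (b * (a * x))))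
      (\<lambda>x. complex_of_real (sqrt (a * b)) * f (a * b * x))"
    by (simp only: L2_rel_def) (auto intro: square_integrable_dilate)
qed

text \<open>From a (x - b) = a x - a b. With a = 2 it moves \<open>translation k\<close> past
  \<open>dilation 2\<close> and doubles the shift, the source of the even index 2k below.\<close>

lemma translation_dilation:
  "translation b (dilation a f) = dilation a (translation (a * b) f)"
proof transfer
  fix a b :: real and f :: "real \<Rightarrow> complex"
  assume "L2_rel f f"
  then have "square_integrable f" by (simp add: L2_rel_def)
  then have "square_integrable (\<lambda>x. complex_of_real (sqrt a) * f (a * x - a * b))"
    using square_integrable_dilate[OF square_integrable_translate[of f "a * b"]] by blast
  then show "L2_rel (\<lambda>x. complex_of_real (sqrt a) * f (a * (x - b)))
      (\<lambda>x. complex_of_real (sqrt a) * f (a * x - a * b))"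
    by (simp add: L2_rel_def right_diff_distrib)
qed

lemma norm_translation: "norm (translation b f) = norm f"
proof transfer
  fix b :: real and f :: "real \<Rightarrow> complex"
  show "sqrt (\<integral>x. (cmod (f (x - b)))\<^sup>2 \<partial>lborel) = sqrt (\<integral>x. (cmod (f x))\<^sup>2 \<partial>lborel)"
    using lborel_integral_real_affine[of 1 "\<lambda>x. (cmod (f x))\<^sup>2" "- b"] by simp
qed

lemma norm_dilation:
  assumes "a > 0"
  shows "norm (dilation a f) = norm f"
  using assms
proof transfer
  fix a :: real and f :: "real \<Rightarrow> complex"
  assume "0 < a"
  then show "sqrt (\<integral>x. (cmod (complex_of_real (sqrt a) * f (a * x)))\<^sup>2 \<partial>lborel) =
      sqrt (\<integral>x. (cmod (f x))\<^sup>2 \<partial>lborel)"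
    using lborel_integral_real_affine[of a "\<lambda>x. (cmod (f x))\<^sup>2" 0]
    by (simp add: norm_mult power_mult_distrib)
qed

lemma norm_wavelet_system: "norm (wavelet_system f i) = norm f"
  by (cases i) (simp add: wavelet_system_def norm_dilation norm_translation)

lemma wavelet_system_add: "wavelet_system (f + g) i = wavelet_system f i + wavelet_system g i"
  by (cases i) (simp add: wavelet_system_def translation_add dilation_add)

lemma wavelet_system_diff: "wavelet_system (f - g) i = wavelet_system f i - wavelet_system g i"
  using wavelet_system_add[of "f - g" g i] by (simp add: eq_diff_eq)

lemma wavelet_system_perturbed:
  "wavelet_system (\<psi> + \<eta> *\<^sub>R dilation 2 \<psi>) (j, k) =
    wavelet_system \<psi> (j, k) + \<eta> *\<^sub>R wavelet_system \<psi> (j + 1, 2 * k)"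
  by (simp add: wavelet_system_def translation_add translation_scaleR dilation_add
      dilation_scaleR translation_dilation dilation_dilation power_int_add)

text \<open>The bound passes from the error operator to its adjoint. Since \<open>F\<close> contains
  every index with a nonzero coefficient of \<open>e\<close>, the adjoint series is a finite sum,
  and only the original series raises a question of convergence.\<close>

lemma norm_analysis_error_le:
  fixes \<theta> \<phi> :: "'i \<Rightarrow> L2"
  assumes bound: "\<And>f. norm f = 1 \<Longrightarrow>
      norm (f - (\<Sum>\<^sub>\<infinity>i. cinner f (\<phi> i) *\<^sub>C \<theta> i)) \<le> \<delta>"
    and \<delta>: "0 \<le> \<delta>" "\<delta> < 1"
    and F: "finite F" "\<And>i. i \<notin> F \<Longrightarrow> cinner e (\<theta> i) = 0"
  shows "norm (e - (\<Sum>i\<in>F. cinner e (\<theta> i) *\<^sub>C \<phi> i)) \<le> \<delta> * norm e"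
proof -
  define g where "g = e - (\<Sum>i\<in>F. cinner e (\<theta> i) *\<^sub>C \<phi> i)"
  have "norm g \<le> \<delta> * norm e"
  proof (cases "g = 0")
    case False
    \<comment> \<open>The unit vector in the direction of \<open>g\<close>, so that
      \<open>inner f g = norm g\<close>.\<close>
    define f where "f = g /\<^sub>R norm g"
    define S where "S = (\<Sum>\<^sub>\<infinity>i. cinner f (\<phi> i) *\<^sub>C \<theta> i)"
    have unit: "norm f = 1" using False by (simp add: f_def)
    \<comment> \<open>\<open>infsum\<close> is \<open>0\<close> on a family that is not summable, and then the error would be \<open>1\<close>.\<close>
    have "(\<lambda>i. cinner f (\<phi> i) *\<^sub>C \<theta> i) summable_on UNIV"
      using bound[OF unit] unit \<delta> by (metis diff_zero infsum_not_exists not_less)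
    then have "((\<lambda>i. cinner f (\<phi> i) *\<^sub>C \<theta> i) has_sum S) UNIV"
      unfolding S_def by (rule has_sum_infsum)
    then have "((\<lambda>i. inner (cinner f (\<phi> i) *\<^sub>C \<theta> i) e) has_sum inner S e) UNIV"
      using has_sum_bounded_linear[OF bounded_linear_inner_left] by blast
    \<comment> \<open>Both sides are the real part of <f, \<phi>_i> <\<theta>_i, e>.\<close>
    moreover have "inner (cinner f (\<phi> i) *\<^sub>C \<theta> i) e = inner f (cinner e (\<theta> i) *\<^sub>C \<phi> i)" for i
      by (simp only: inner_scaleC_left inner_scaleC_right cinner_commute[symmetric] mult.commute)
    ultimately have 1: "((\<lambda>i. inner f (cinner e (\<theta> i) *\<^sub>C \<phi> i)) has_sum inner S e) UNIV"
      by simp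
    have "((\<lambda>i. inner f (cinner e (\<theta> i) *\<^sub>C \<phi> i)) has_sum
        (\<Sum>i\<in>F. inner f (cinner e (\<theta> i) *\<^sub>C \<phi> i))) UNIV"
      using F by (intro has_sum_finite_neutralI) (auto simp: inner_scaleC_right)
    with 1 have "inner S e = (\<Sum>i\<in>F. inner f (cinner e (\<theta> i) *\<^sub>C \<phi> i))"
      by (rule has_sum_unique)
    then have "inner (f - S) e = inner f g"
      by (simp add: g_def inner_diff_left inner_diff_right inner_sum_right)
    also have "\<dots> = norm g"
      using False by (simp add: f_def dot_square_norm power2_eq_square)
    finally have "norm g \<le> norm (f - S) * norm e"
      using norm_cauchy_schwarz[of "f - S" e] by simp
    also have "\<dots> \<le> \<delta> * norm e"
      using bound[OF unit] by (intro mult_right_mono) (auto simp: S_def)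
    finally show ?thesis .
  qed (use \<delta> in simp)
  then show ?thesis by (simp add: g_def)
qed

text \<open>The root of the claimed bound lies strictly below the threshold \<eta> / (2 + \<eta>) of
  the geometric argument. It is at most \<eta>^2 / (2 (1 + \<eta>)), by an estimate that removes the
  square root. The second part permits passing between squares and roots.\<close>

lemma wavelet_bound_less:
  fixes \<eta> :: real
  assumes "0 < \<eta>" "\<eta> < 1"
  shows "(1 - \<eta>) / 2 * (1 / sqrt (1 - \<eta>\<^sup>2) - 1) < \<eta> / (2 + \<eta>)"
    and "0 \<le> (1 - \<eta>) / 2 * (1 / sqrt (1 - \<eta>\<^sup>2) - 1)"
proof -
  define s where "s = sqrt (1 - \<eta>\<^sup>2)"
  have \<eta>2: "\<eta>\<^sup>2 < 1" using assms by (simp add: power_less_one_iff abs_square_less_1)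
  have s: "0 < s" "s \<le> 1" "s\<^sup>2 = (1 - \<eta>) * (1 + \<eta>)"
    using \<eta>2 assms by (auto simp: s_def algebra_simps power2_eq_square)
  have le: "(1 - \<eta>) / s \<le> 1 / (1 + \<eta>)"
  proof -
    \<comment> \<open>As s <= 1, s dominates its square (1 - \<eta>) (1 + \<eta>), which is rational
      in \<eta>.\<close>
    have "s * s \<le> s * 1" using s by (intro mult_left_mono) auto
    then have "(1 - \<eta>) * (1 + \<eta>) \<le> s" using s(3) by (simp add: power2_eq_square)
    then show ?thesis using s assms by (simp add: field_simps)
  qed
  have "(1 - \<eta>) / 2 * (1 / s - 1) = ((1 - \<eta>) / s - (1 - \<eta>)) / 2"
    by (simp add: field_simps)
  also have "\<dots> \<le> (1 / (1 + \<eta>) - (1 - \<eta>)) / 2"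
    by (intro divide_right_mono diff_right_mono le) simp
  also have "\<dots> = \<eta> * \<eta> / (2 * (1 + \<eta>))" using assms by (simp add: field_simps)
  also have "\<dots> < \<eta> / (2 + \<eta>)"
  proof -
    \<comment> \<open>Cross-multiplied, the goal is \<eta>^2 (2 + \<eta>) < 2 \<eta> (1 + \<eta>),
      where 2 \<eta>^2 cancels.\<close>
    have "\<eta> * (\<eta> * \<eta>) < \<eta> * 2"
      using assms \<eta>2 by (intro mult_strict_left_mono) (auto simp: power2_eq_square)
    then show ?thesis using assms by (simp add: field_simps)
  qed
  finally show "(1 - \<eta>) / 2 * (1 / sqrt (1 - \<eta>\<^sup>2) - 1) < \<eta> / (2 + \<eta>)"
    by (simp add: s_def)
  show "0 \<le> (1 - \<eta>) / 2 * (1 / sqrt (1 - \<eta>\<^sup>2) - 1)"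
    using s assms unfolding s_def[symmetric] by (intro mult_nonneg_nonneg) auto
qed

theorem mainTheorem2:
  fixes \<psi> \<theta> \<phi> :: L2 and \<eta> :: real
  assumes "orthonormal_basis (wavelet_system \<psi>)"
    and "0 < \<eta>" and "\<eta> < 1"
    and "\<theta> = \<psi> + \<eta> *\<^sub>R dilation 2 \<psi>"
    and "bessel_sequence (wavelet_system \<phi>)"
  shows "(SUP f\<in>{f. norm f = 1}.
            ereal ((norm (f - (\<Sum>\<^sub>\<infinity>i\<in>UNIV.
              cinner f (wavelet_system \<phi> i) *\<^sub>C wavelet_system \<theta> i)))\<^sup>2))
         \<ge> ereal ((1 - \<eta>)\<^sup>2 / 4 * (1 / sqrt (1 - \<eta>\<^sup>2) - 1)\<^sup>2)"
proof (rule ccontr)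
  define \<delta> where "\<delta> = (1 - \<eta>) / 2 * (1 / sqrt (1 - \<eta>\<^sup>2) - 1)"
  have \<delta>: "\<delta> < \<eta> / (2 + \<eta>)" "0 \<le> \<delta>"
    using wavelet_bound_less[OF assms(2,3)] by (simp_all add: \<delta>_def)
  have "\<eta> / (2 + \<eta>) < 1" using assms(2) by simp
  \<comment> \<open>This lets \<open>norm_analysis_error_le\<close> rule out series that do not
    converge, whose error would be 1.\<close>
  with \<delta> have "\<delta> < 1" by linarith
  have \<delta>2: "(1 - \<eta>)\<^sup>2 / 4 * (1 / sqrt (1 - \<eta>\<^sup>2) - 1)\<^sup>2 = \<delta>\<^sup>2"
    unfolding \<delta>_def power_mult_distrib power_divide by simp
  assume "\<not> ?thesis"
  then have SUP: "(SUP f\<in>{f. norm f = 1}.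
            ereal ((norm (f - (\<Sum>\<^sub>\<infinity>i\<in>UNIV.
              cinner f (wavelet_system \<phi> i) *\<^sub>C wavelet_system \<theta> i)))\<^sup>2)) < ereal (\<delta>\<^sup>2)"
    unfolding \<delta>2 by (simp only: not_le)
  \<comment> \<open>A supremum below \<delta>^2 bounds each single error; roots may be taken because
    \<delta> is nonnegative.\<close>
  have bound: "norm (f - (\<Sum>\<^sub>\<infinity>i. cinner f (wavelet_system \<phi> i) *\<^sub>C wavelet_system \<theta> i)) \<le> \<delta>"
    if "norm f = 1" for f
  proof -
    have "ereal ((norm (f - (\<Sum>\<^sub>\<infinity>i. cinner f (wavelet_system \<phi> i) *\<^sub>C wavelet_system \<theta> i)))\<^sup>2)
        < ereal (\<delta>\<^sup>2)"
      using SUP_lessD[OF SUP, of f] that by (simp only: mem_Collect_eq)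
    then show ?thesis
      unfolding less_ereal.simps(1) by (rule power2_le_imp_le[OF less_imp_le \<open>0 \<le> \<delta>\<close>])
  qed
  have orth: "cinner (wavelet_system \<psi> i) (wavelet_system \<psi> m) = (if i = m then 1 else 0)" for i m
    using assms(1) unfolding orthonormal_basis_def by blast
  have coeff: "cinner (wavelet_system \<psi> m) (wavelet_system \<theta> (j, k)) =
      (if m = (j, k) then 1 else 0) + \<eta> * (if m = (j + 1, 2 * k) then 1 else 0)" for m j k
    by (simp add: assms(4) wavelet_system_perturbed cinner_add_right cinner_scaleR_right orth)
  have "complex_of_real ((norm \<psi>)\<^sup>2) = 1"
    using orth[of "(0, 0)" "(0, 0)"] by (simp add: cinner_self norm_wavelet_system)
  then have "(norm \<psi>)\<^sup>2 = 1" by (simp only: of_real_eq_1_iff)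
  then have norm_\<psi>: "norm \<psi> = 1"
    using norm_ge_zero[of \<psi>] unfolding power2_eq_1_iff by linarith
  have "norm (wavelet_system \<psi> (0, 1) -
      (\<Sum>i\<in>{(0, 1)}. cinner (wavelet_system \<psi> (0, 1)) (wavelet_system \<theta> i) *\<^sub>C wavelet_system \<phi> i))
      \<le> \<delta> * norm (wavelet_system \<psi> (0, 1))"
  proof (rule norm_analysis_error_le[OF bound \<open>0 \<le> \<delta>\<close> \<open>\<delta> < 1\<close>])
    fix i :: "int \<times> int"
    assume "i \<notin> {(0, 1)}"
    \<comment> \<open>Parity: (j + 1, 2k) = (0, 1) is impossible, so only the unperturbed term
      contributes.\<close>
    moreover have "(1::int) \<noteq> 2 * snd i" by presburger
    ultimately show "cinner (wavelet_system \<psi> (0, 1)) (wavelet_system \<theta> i) = 0"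
      by (cases i) (auto simp: coeff)
  qed auto
  then have "norm (wavelet_system \<psi> (0, 1) - wavelet_system \<phi> (0, 1)) \<le> \<delta>"
    by (simp add: coeff norm_wavelet_system norm_\<psi>)
  \<comment> \<open>Both vectors carry the same index, and the map to that index is a linear
    isometry, so it can be stripped off.\<close>
  then have A: "norm (\<psi> - \<phi>) \<le> \<delta>"
    by (simp only: wavelet_system_diff[symmetric] norm_wavelet_system)
  \<comment> \<open>Here (j + 1, 2k) = (0, 0) has the solution (-1, 0), which contributes the
    coefficient \<eta>.\<close>
  have "norm (wavelet_system \<psi> (0, 0) - (\<Sum>i\<in>{(0, 0), (-1, 0)}.
        cinner (wavelet_system \<psi> (0, 0)) (wavelet_system \<theta> i) *\<^sub>C wavelet_system \<phi> i))
      \<le> \<delta> * norm (wavelet_system \<psi> (0, 0))"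
  proof (rule norm_analysis_error_le[OF bound \<open>0 \<le> \<delta>\<close> \<open>\<delta> < 1\<close>])
    fix i :: "int \<times> int"
    assume "i \<notin> {(0, 0), (-1, 0)}"
    then show "cinner (wavelet_system \<psi> (0, 0)) (wavelet_system \<theta> i) = 0"
      by (cases i) (auto simp: coeff)
  qed auto
  then have "norm (wavelet_system \<psi> (0, 0) - (wavelet_system \<phi> (0, 0) +
      \<eta> *\<^sub>R wavelet_system \<phi> (-1, 0))) \<le> \<delta>"
    by (simp add: coeff norm_wavelet_system norm_\<psi> scaleR_scaleC)
  moreover have "wavelet_system f (0, 0) = f" for f
  proof -
    have "translation 0 f = f" "dilation 1 f = f"
      by (transfer, simp add: L2_rel_def)+
    then show ?thesis by (simp add: wavelet_system_def)
  qed
  ultimately have B: "norm (\<psi> - \<phi> - \<eta> *\<^sub>R wavelet_system \<phi> (-1, 0)) \<le> \<delta>"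
    by (simp add: diff_diff_eq)
  \<comment> \<open>This vector is the difference of those in \<open>A\<close> and
    \<open>B\<close>.\<close>
  have "norm (\<eta> *\<^sub>R wavelet_system \<phi> (-1, 0)) \<le> 2 * \<delta>"
    using A B norm_triangle_ineq4[of "\<psi> - \<phi>" "\<psi> - \<phi> - \<eta> *\<^sub>R wavelet_system \<phi> (-1, 0)"] by simp
  then have "\<eta> * norm \<phi> \<le> 2 * \<delta>"
    using assms(2) by (simp add: norm_wavelet_system)
  \<comment> \<open>\<open>A\<close> also keeps \<phi> from being small, as \<psi> has norm
    1.\<close>
  moreover have "1 - \<delta> \<le> norm \<phi>"
    using A norm_\<psi> norm_triangle_ineq2[of \<psi> \<phi>] by linarith
  then have "\<eta> * (1 - \<delta>) \<le> \<eta> * norm \<phi>"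
    using assms(2) by (intro mult_left_mono) auto
  ultimately have "\<eta> \<le> \<delta> * (2 + \<eta>)" by (simp add: algebra_simps)
  then show False using \<delta>(1) assms(2) by (simp add: field_simps)
qed

end
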